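(* Let $\mathbb{F}$ be a field with $\mathrm{char}(\mathbb{F})=0$ and let $f\colon \mathbb{F}\to \mathbb{C}$ be a quadratic function that can be represented as \[ f(x)= a_{1}(x)a_{2}(x) \qquad (x\in \mathbb{F}) \] with the aid of additive functions $a_{1}, a_{2}\colon \mathbb{F}\to \mathbb{C}$. Then the equation \[ f(x^{2})= f(x)^{2} \] holds for each $x\in \mathbb{F}$ if and only if there exist complex-valued non-trivial homomorphisms $\varphi_{1}, \varphi_{2}$ defined on $\mathbb{F}$ such that \[ f(x)= f(1)\cdot \varphi_{1}(x)\varphi_{2}(x) \qquad (x\in \mathbb{F}). \] Furthermore, (A) either $f(1)=0$ and then $f$ is identically zero; (B) or $f(1)=1$.
   Context: A function $a\colon \mathbb{F}\to\mathbb{C}$ is additive if $a(x+y)=a(x)+a(y)$ for all $x,y\in\mathbb{F}$. A function $f\colon \mathbb{F}\to\mathbb{C}$ is quadratic (a generalized monomial of degree $2$) if there is a symmetric bi-additive function $F\colon \mathbb{F}^2\to\mathbb{C}$ (additive in each variable) with $f(x)=F(x,x)$ for all $x\in\mathbb{F}$. A homomorphism $\varphi\colon\mathbb{F}\to\mathbb{C}$ is a map with $\varphi(x+y)=\varphi(x)+\varphi(y)$ and $\varphi(xy)=\varphi(x)\varphi(y)$ for all $x,y\in\mathbb{F}$. The trivial homomorphisms are the identically zero map and, where it makes sense (for instance for $\mathbb{F}=\mathbb{C}$ or $\mathbb{F}=\mathbb{R}$), the identity map; a homomorphism is non-trivial if it is not one of these.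
   Formalization: "Non-trivial" means not identically zero (the identity is allowed: f(x)=x² needs it); f(1)∈{0,1} is added to the right side of the equivalence (2φ₁φ₂ fails otherwise); the equivalence is not claimed when f≡0 and no nonzero homomorphism F→ℂ exists. *)

theory Defs
  imports Complex_Main
begin

definition quadratic :: "('a::field_char_0 \<Rightarrow> complex) \<Rightarrow> bool" where
  "quadratic f \<longleftrightarrow>
     (\<exists>F. (\<forall>x y. F x y = F y x) \<and>
          (\<forall>x. additive (\<lambda>y. F x y)) \<and> (\<forall>y. additive (\<lambda>x. F x y)) \<and>
          (\<forall>x. f x = F x x))"

definition homomorphism :: "('a::field_char_0 \<Rightarrow> complex) \<Rightarrow> bool" where
  "homomorphism \<phi> \<longleftrightarrow>
     (\<forall>x y. \<phi> (x + y) = \<phi> x + \<phi> y) \<and> (\<forall>x y. \<phi> (x * y) = \<phi> x * \<phi> y)"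

text \<open>
  The domain is an arbitrary field of characteristic 0, with no inclusion into the complex
  numbers given, so there is no identity map to exclude and only the zero map counts as trivial.
  On the complex numbers the identity has to be admitted: the only way to write
  \<open>x\<^sup>2\<close> as a product of two nonzero homomorphisms there is \<open>x * x\<close>.
\<close>

definition nontrivial_hom :: "('a::field_char_0 \<Rightarrow> complex) \<Rightarrow> bool" where
  "nontrivial_hom \<phi> \<longleftrightarrow> homomorphism \<phi> \<and> \<not> (\<forall>x. \<phi> x = 0)"

end

theory Submission
  imports Defs
begin

text \<open>
  Substitute \<open>x + n\<close> for \<open>x\<close> in \<open>a(x\<^sup>2) b(x\<^sup>2) = a(x)\<^sup>2 b(x)\<^sup>2\<close> and compare the coefficients of
  the powers of \<open>n\<close>. If \<open>a(1) b(1) = 0\<close>, they give \<open>a(x) b(x) = 0\<close>. Otherwise one may scale to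
  \<open>a(1) = b(1) = 1\<close>; then \<open>a(x\<^sup>2) + b(x\<^sup>2) = a(x)\<^sup>2 + b(x)\<^sup>2\<close> and
  \<open>a(x\<^sup>2) b(x) + a(x) b(x\<^sup>2) = a(x) b(x) (a(x) + b(x))\<close>, which together with the original equation
  force \<open>a(x\<^sup>2) = a(x)\<^sup>2\<close> and \<open>b(x\<^sup>2) = b(x)\<^sup>2\<close>. An additive map preserving squares is a
  homomorphism by polarization.
\<close>

text \<open>The hypotheses are the values of \<open>D1 * n + D2 * n^2 + D3 * n^3\<close>, up to sign
  of none, at \<open>n = 1\<close>, \<open>n = -1\<close> and \<open>n = 2\<close>; a cubic with the
  four roots 0, 1, -1, 2 is zero.\<close>

lemma cubic_coefficients_zero:
  fixes D1 D2 D3 :: "'a::field_char_0"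
  assumes "D1 + D2 + D3 = 0" "D2 - D1 - D3 = 0" "2 * D1 + 4 * D2 + 8 * D3 = 0"
  shows "D1 = 0" "D2 = 0" "D3 = 0"
proof -
  have "2 * D2 = (D1 + D2 + D3) + (D2 - D1 - D3)" by (simp add: algebra_simps)
  then show D2: "D2 = 0" using assms by simp
  have "6 * D3 = (2 * D1 + 4 * D2 + 8 * D3) - 2 * (D1 + D2 + D3) - 2 * D2"
    by (simp add: algebra_simps)
  then show D3: "D3 = 0" unfolding assms(1,3) unfolding D2 by simp
  show "D1 = 0" using assms(1) D2 D3 by simp
qed

lemma additive_double:
  fixes a :: "'a::ring_1 \<Rightarrow> 'b::ring_1"
  assumes "additive a"
  shows "a (2 * x) = 2 * a x"
  by (simp add: mult_2 additive.add[OF assms])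

text \<open>Both sides of \<open>eq\<close> at \<open>x + n\<close> are polynomials in
  \<open>n\<close> of degree at most 4. The three conclusions compare the coefficients of
  \<open>n\<close>, \<open>n^2\<close> and \<open>n^3\<close>; those of \<open>n^0\<close> and
  \<open>n^4\<close> already agree by \<open>eq\<close> at \<open>x\<close> and at 1.\<close>

lemma
  fixes a b :: "'a::comm_ring_1 \<Rightarrow> complex"
  assumes a: "additive a" and b: "additive b"
    and eq: "\<And>x. a (x\<^sup>2) * b (x\<^sup>2) = (a x * b x)\<^sup>2"
  shows additive_product_coeff1:
      "a (x\<^sup>2) * b x + a x * b (x\<^sup>2) = a x * b x * (a x * b 1 + a 1 * b x)"
    and additive_product_coeff2:
      "a (x\<^sup>2) * b 1 + a 1 * b (x\<^sup>2) = (a x)\<^sup>2 * (b 1)\<^sup>2 + (a 1)\<^sup>2 * (b x)\<^sup>2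
         + 4 * (a 1 * b 1 - 1) * (a x * b x)"
    and additive_product_coeff3:
      "a x * b 1 + a 1 * b x = a 1 * b 1 * (a x * b 1 + a 1 * b x)"
proof -
  note add = additive.add[OF a] additive.add[OF b] additive.diff[OF a] additive.diff[OF b]
    additive_double[OF a] additive_double[OF b]
  define D1 where "D1 = 2 * (a (x\<^sup>2) * b x + a x * b (x\<^sup>2) - a x * b x * (a x * b 1 + a 1 * b x))"
  define D2 where "D2 = a (x\<^sup>2) * b 1 + a 1 * b (x\<^sup>2) - ((a x)\<^sup>2 * (b 1)\<^sup>2 + (a 1)\<^sup>2 * (b x)\<^sup>2
         + 4 * (a 1 * b 1 - 1) * (a x * b x))"
  define D3 where "D3 = 2 * (a x * b 1 + a 1 * b x - a 1 * b 1 * (a x * b 1 + a 1 * b x))"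
  have e0: "a (x\<^sup>2) * b (x\<^sup>2) = (a x * b x)\<^sup>2" and e4: "a 1 * b 1 = (a 1 * b 1)\<^sup>2"
    using eq[of x] eq[of 1] by simp_all
  \<comment> \<open>The constant 2 is written as \<open>2 * 1\<close> so that additivity expresses
    its image through \<open>a 1\<close> and \<open>b 1\<close>.\<close>
  have sq: "(x + 1)\<^sup>2 = x\<^sup>2 + 2 * x + 1" "(x - 1)\<^sup>2 = x\<^sup>2 - 2 * x + 1"
    "(x + 2 * 1)\<^sup>2 = x\<^sup>2 + 2 * (2 * x) + 2 * (2 * 1)"
    by (simp_all add: power2_eq_square algebra_simps)
  have p1: "(a (x\<^sup>2) + 2 * a x + a 1) * (b (x\<^sup>2) + 2 * b x + b 1)
      = ((a x + a 1) * (b x + b 1))\<^sup>2"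
    using eq[of "x + 1"] unfolding sq by (simp add: add)
  have m1: "(a (x\<^sup>2) - 2 * a x + a 1) * (b (x\<^sup>2) - 2 * b x + b 1)
      = ((a x - a 1) * (b x - b 1))\<^sup>2"
    using eq[of "x - 1"] unfolding sq by (simp add: add)
  have p2: "(a (x\<^sup>2) + 4 * a x + 4 * a 1) * (b (x\<^sup>2) + 4 * b x + 4 * b 1)
      = ((a x + 2 * a 1) * (b x + 2 * b 1))\<^sup>2"
    using eq[of "x + 2 * 1"] unfolding sq add by simp
  \<comment> \<open>With \<open>e0\<close> and \<open>e4\<close> removing the outer coefficients,
    \<open>p1\<close>, \<open>m1\<close> and \<open>p2\<close> say that the remaining cubic in
    \<open>n\<close> vanishes at 1, -1 and 2.\<close>
  have "D1 + D2 + D3 = 0" "D2 - D1 - D3 = 0" "2 * D1 + 4 * D2 + 8 * D3 = 0"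
    unfolding D1_def D2_def D3_def using e0 e4 p1 m1 p2 by algebra+
  note cubic_coefficients_zero[OF this]
  then show "a (x\<^sup>2) * b x + a x * b (x\<^sup>2) = a x * b x * (a x * b 1 + a 1 * b x)"
    "a (x\<^sup>2) * b 1 + a 1 * b (x\<^sup>2) = (a x)\<^sup>2 * (b 1)\<^sup>2 + (a 1)\<^sup>2 * (b x)\<^sup>2
         + 4 * (a 1 * b 1 - 1) * (a x * b x)"
    "a x * b 1 + a 1 * b x = a 1 * b 1 * (a x * b 1 + a 1 * b x)"
    unfolding D1_def D2_def D3_def
    by (simp_all add: mult_eq_0_iff del: right_diff_distrib_numeral mult_cancel_right1 mult_cancel_left1)
qed

lemma homomorphism_if_preserves_squares:
  assumes a: "additive a" and sq: "\<And>x. a (x\<^sup>2) = (a x)\<^sup>2"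
  shows "homomorphism a"
proof -
  note add = additive.add[OF a]
  have "a (x * y) = a x * a y" for x y
  proof -
    have "(x + y)\<^sup>2 = x\<^sup>2 + y\<^sup>2 + 2 * (x * y)"
      by (simp add: power2_eq_square algebra_simps)
    then have "(a x + a y)\<^sup>2 = (a x)\<^sup>2 + (a y)\<^sup>2 + 2 * a (x * y)"
      using sq[of "x + y"] by (simp add: add additive_double[OF a] sq)
    then show ?thesis by (simp add: power2_sum)
  qed
  then show ?thesis by (simp add: homomorphism_def add)
qed

text \<open>Put \<open>A = a (x^2) - (a x)^2\<close> and \<open>B = b (x^2) - (b x)^2\<close>. The
  second coefficient gives \<open>A + B = 0\<close>, the first \<open>A * b x + a x * B = 0\<close>,
  hence \<open>A * (b x - a x) = 0\<close>. If \<open>a x = b x\<close>, the original equation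
  becomes \<open>A^2 = 0\<close>.\<close>

lemma preserves_squares_if_normalized:
  fixes a b :: "'a::comm_ring_1 \<Rightarrow> complex"
  assumes "additive a" "additive b" "\<And>x. a (x\<^sup>2) * b (x\<^sup>2) = (a x * b x)\<^sup>2"
    and one: "a 1 = 1" "b 1 = 1"
  shows "a (x\<^sup>2) = (a x)\<^sup>2"
proof -
  have prod: "a (x\<^sup>2) * b (x\<^sup>2) = (a x * b x)\<^sup>2" by fact
  have mixed: "a (x\<^sup>2) * b x + a x * b (x\<^sup>2) = a x * b x * (a x + b x)"
    using additive_product_coeff1[OF assms(1-3), of x] one by simp
  have sum: "a (x\<^sup>2) + b (x\<^sup>2) = (a x)\<^sup>2 + (b x)\<^sup>2"
    using additive_product_coeff2[OF assms(1-3), of x] one by simp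
  show ?thesis
  proof (cases "a x = b x")
    case True
    have "(a (x\<^sup>2) - (a x)\<^sup>2)\<^sup>2 = 0"
      using prod sum True by algebra
    then show ?thesis by simp
  next
    case False
    have "(a (x\<^sup>2) - (a x)\<^sup>2) * (b x - a x) = 0"
      using mixed sum by algebra
    then show ?thesis using False by simp
  qed
qed

lemma product_zero_if_zero_at_one:
  fixes a b :: "'a::comm_ring_1 \<Rightarrow> complex"
  assumes "additive a" "additive b" "\<And>x. a (x\<^sup>2) * b (x\<^sup>2) = (a x * b x)\<^sup>2"
    and zero: "a 1 * b 1 = 0"
  shows "a x * b x = 0"
proof -
  have cross: "a x * b 1 + a 1 * b x = 0"
    using additive_product_coeff3[OF assms(1-3), of x] zero by simp
  consider "a 1 = 0" "b 1 = 0" | "a 1 = 0" "b 1 \<noteq> 0" | "a 1 \<noteq> 0" "b 1 = 0"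
    using zero by auto
  then show ?thesis
  proof cases
    case 1
    \<comment> \<open>With \<open>a 1 = b 1 = 0\<close> the identity collapses to
      \<open>0 = -4 * (a x * b x)\<close>. In the other two cases \<open>cross\<close> makes one
      factor vanish at \<open>x\<close>.\<close>
    then show ?thesis using additive_product_coeff2[OF assms(1-3), of x] by simp
  qed (use cross in auto)
qed

lemma additive_divide:
  fixes a :: "'a::ab_group_add \<Rightarrow> complex"
  assumes "additive a"
  shows "additive (\<lambda>x. a x / c)"
  by standard (simp add: additive.add[OF assms] add_divide_distrib)

text \<open>Dividing each factor by its value at 1 leaves the product unchanged, because
  \<open>a 1 * b 1 = 1\<close>, and makes both factors normalized.\<close>

lemma additive_factors_proportional_to_homs:
  fixes a b :: "'a::field_char_0 \<Rightarrow> complex"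
  assumes a: "additive a" and b: "additive b"
    and eq: "\<And>x. a (x\<^sup>2) * b (x\<^sup>2) = (a x * b x)\<^sup>2"
    and one: "a 1 * b 1 = 1"
  shows "nontrivial_hom (\<lambda>x. a x / a 1)" "nontrivial_hom (\<lambda>x. b x / b 1)"
proof -
  have nz: "a 1 \<noteq> 0" "b 1 \<noteq> 0" using one by auto
  note a' = additive_divide[OF a, of "a 1"] and b' = additive_divide[OF b, of "b 1"]
  have eq': "a (x\<^sup>2) / a 1 * (b (x\<^sup>2) / b 1) = (a x / a 1 * (b x / b 1))\<^sup>2" for x
    by (simp add: eq one)
  have "a (x\<^sup>2) / a 1 = (a x / a 1)\<^sup>2" for x
    using preserves_squares_if_normalized[OF a' b' eq'] nz by simp
  moreover have "b (x\<^sup>2) / b 1 = (b x / b 1)\<^sup>2" for x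
    using preserves_squares_if_normalized[OF b' a'] eq' nz by (simp add: mult.commute)
  ultimately show "nontrivial_hom (\<lambda>x. a x / a 1)" "nontrivial_hom (\<lambda>x. b x / b 1)"
    unfolding nontrivial_hom_def
    using homomorphism_if_preserves_squares[OF a'] homomorphism_if_preserves_squares[OF b'] nz
    by (auto intro: exI[of _ 1])
qed

text \<open>The premise of the first part excludes only \<open>f = 0\<close> on a field without
  nonzero homomorphisms into the complex numbers, where no factorization exists although the
  equation holds. The condition on \<open>f 1\<close> belongs to the right-hand side because
  \<open>2 * (\<phi>1 x * \<phi>2 x)\<close> has the required form but violates the
  equation.\<close>

theorem proposition2:
  fixes f a1 a2 :: "'a::field_char_0 \<Rightarrow> complex"
  assumes "quadratic f"
    and "additive a1" and "additive a2"
    and "\<forall>x. f x = a1 x * a2 x"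
  shows "((\<exists>x. f x \<noteq> 0) \<or> (\<exists>\<psi> :: 'a \<Rightarrow> complex. nontrivial_hom \<psi>) \<longrightarrow>
           ((\<forall>x. f (x\<^sup>2) = (f x)\<^sup>2) \<longleftrightarrow>
             (\<exists>\<phi>1 \<phi>2. nontrivial_hom \<phi>1 \<and> nontrivial_hom \<phi>2 \<and>
                (\<forall>x. f x = f 1 * (\<phi>1 x * \<phi>2 x))) \<and> (f 1 = 0 \<or> f 1 = 1)))
       \<and> ((\<forall>x. f (x\<^sup>2) = (f x)\<^sup>2) \<longrightarrow>
           (f 1 = 0 \<and> (\<forall>x. f x = 0)) \<or> f 1 = 1)"
proof -
  have f: "f x = a1 x * a2 x" for x using assms(4) by blast
  have dichotomy: "(f 1 = 0 \<and> (\<forall>x. f x = 0)) \<or> f 1 = 1" if "\<forall>x. f (x\<^sup>2) = (f x)\<^sup>2"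
  proof -
    have "f 1 = (f 1)\<^sup>2" using that[rule_format, of 1] by simp
    then have "f 1 = 0 \<or> f 1 = 1" by (simp add: power2_eq_square)
    then show ?thesis
      using product_zero_if_zero_at_one[OF assms(2,3)] that unfolding f by blast
  qed
  have factor: "\<exists>\<phi>1 \<phi>2. nontrivial_hom \<phi>1 \<and> nontrivial_hom \<phi>2 \<and> (\<forall>x. f x = f 1 * (\<phi>1 x * \<phi>2 x))"
    if eq: "\<forall>x. f (x\<^sup>2) = (f x)\<^sup>2"
      and ex: "(\<exists>x. f x \<noteq> 0) \<or> (\<exists>\<psi> :: 'a \<Rightarrow> complex. nontrivial_hom \<psi>)"
  proof (cases "f 1 = 1")
    case True
    then have "nontrivial_hom (\<lambda>x. a1 x / a1 1)" "nontrivial_hom (\<lambda>x. a2 x / a2 1)"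
      using additive_factors_proportional_to_homs[OF assms(2,3)] eq unfolding f by blast+
    moreover have "f x = f 1 * (a1 x / a1 1 * (a2 x / a2 1))" for x
      using True by (simp add: f)
    ultimately show ?thesis by blast
  next
    case False
    then have zero: "f x = 0" for x using dichotomy[OF eq] by blast
    \<comment> \<open>Since \<open>f 1 = 0\<close>, any nontrivial homomorphism can serve as both
      factors.\<close>
    with ex obtain \<psi> :: "'a \<Rightarrow> complex" where "nontrivial_hom \<psi>" by blast
    then show ?thesis using zero by auto
  qed
  have converse: "\<forall>x. f (x\<^sup>2) = (f x)\<^sup>2"
    if "nontrivial_hom \<phi>1" "nontrivial_hom \<phi>2" "\<forall>x. f x = f 1 * (\<phi>1 x * \<phi>2 x)"
      and "f 1 = 0 \<or> f 1 = 1" for \<phi>1 \<phi>2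
  proof
    fix x
    have "\<phi>1 (x\<^sup>2) = (\<phi>1 x)\<^sup>2" "\<phi>2 (x\<^sup>2) = (\<phi>2 x)\<^sup>2"
      using that(1,2) by (simp_all add: nontrivial_hom_def homomorphism_def power2_eq_square)
    moreover have "(f 1)\<^sup>2 = f 1" using that(4) by auto
    ultimately have "(f 1 * (\<phi>1 x * \<phi>2 x))\<^sup>2 = f 1 * (\<phi>1 (x\<^sup>2) * \<phi>2 (x\<^sup>2))"
      by (simp add: power_mult_distrib)
    then show "f (x\<^sup>2) = (f x)\<^sup>2"
      using that(3) by metis
  qed
  show ?thesis
    using dichotomy factor converse by blast
qed

end
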